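(* Let $p$ be a prime with $p\equiv 3\pmod 4$ such that the regular continued fraction of $\sqrt{p}$ has period length $8$. Let $x+y\sqrt{p}$ (with $x,y\in\mathbb{Z}$) be the fundamental unit of $\mathbb{Q}(\sqrt{p})$. Then $p$ does not divide $y$.
   Context: For a prime $p$, the regular continued fraction of $\sqrt{p}$ has the form $\sqrt{p}=\langle n,\overline{a_1,a_2,\ldots,a_{l-1},2n}\rangle$, where $n=\lfloor\sqrt{p}\rfloor$ and the bar denotes the repeating block; the period length is the length $l$ of the minimal period. The fundamental unit of $\mathbb{Q}(\sqrt{p})$ is the smallest unit $>1$ of its ring of integers, which is $\mathbb{Z}[\sqrt{p}]$ when $p\equiv 3\pmod 4$. Mordell's conjecture asserts that, for a prime $p\equiv 3\pmod 4$ with fundamental unit $x+y\sqrt{p}$ of $\mathbb{Q}(\sqrt{p})$, $p$ does not divide $y$. *)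

theory Defs
  imports Complex_Main "HOL-Computational_Algebra.Computational_Algebra"
begin

text \<open>
  Only meaningful for irrational \<open>x\<close>, whose regular continued fraction is infinite.  For rational
  \<open>x\<close> the expansion stops, and \<open>1 / 0 = 0\<close> makes all later values \<open>0\<close>.
\<close>
primrec complete_quotient :: "real \<Rightarrow> nat \<Rightarrow> real" where
  "complete_quotient x 0 = x"
| "complete_quotient x (Suc k) = 1 / frac (complete_quotient x k)"

definition partial_quotient :: "real \<Rightarrow> nat \<Rightarrow> int" where
  "partial_quotient x k = \<lfloor>complete_quotient x k\<rfloor>"

text \<open>
  The repeating block starts directly after the integer part, i.e. at index \<open>1\<close>, as it does for
  square roots of non-square natural numbers.
\<close>
definition cf_period :: "real \<Rightarrow> nat \<Rightarrow> bool" where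
  "cf_period x l \<longleftrightarrow> l > 0 \<and> (\<forall>k\<ge>1. partial_quotient x (k + l) = partial_quotient x k)"

definition has_cf_period_length :: "real \<Rightarrow> nat \<Rightarrow> bool" where
  "has_cf_period_length x l \<longleftrightarrow> cf_period x l \<and> (\<forall>m. cf_period x m \<longrightarrow> l \<le> m)"

text \<open>The field \<open>\<rat>(\<surd>d)\<close>, as a subset of \<open>\<real>\<close>.\<close>
definition real_quadratic_field :: "nat \<Rightarrow> real set" where
  "real_quadratic_field d = {a + b * sqrt (real d) | a b. a \<in> \<rat> \<and> b \<in> \<rat>}"

definition ring_of_integers :: "real set \<Rightarrow> real set" where
  "ring_of_integers K = {z \<in> K. algebraic_int z}"

definition units_of_integers :: "real set \<Rightarrow> real set" where
  "units_of_integers K =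
     {u \<in> ring_of_integers K. \<exists>v \<in> ring_of_integers K. u * v = 1}"

definition is_fundamental_unit :: "nat \<Rightarrow> real \<Rightarrow> bool" where
  "is_fundamental_unit d e \<longleftrightarrow>
     e \<in> units_of_integers (real_quadratic_field d) \<and> e > 1 \<and>
     (\<forall>u \<in> units_of_integers (real_quadratic_field d). u > 1 \<longrightarrow> e \<le> u)"

end

theory Submission
  imports Defs
begin

text \<open>
  Write the complete quotients of \<open>\<surd>p\<close> as \<open>(P\<^sub>k + \<surd>p) / Q\<^sub>k\<close> with integers satisfying
  \<open>P\<^sub>k\<^sub>+\<^sub>1 = a\<^sub>k Q\<^sub>k - P\<^sub>k\<close> and \<open>Q\<^sub>k Q\<^sub>k\<^sub>+\<^sub>1 = p - P\<^sub>k\<^sub>+\<^sub>1\<^sup>2\<close>.  Both relations are symmetric under reversal, so a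
  period of length \<open>8\<close> is a palindrome and its centre satisfies \<open>P\<^sub>5 = P\<^sub>4\<close>
  (\<open>surd_palindrome\<close>).  Hence \<open>Q\<^sub>4\<close> divides \<open>2 P\<^sub>4\<close> as well as \<open>p - P\<^sub>4\<^sup>2\<close>, so it divides \<open>2 p\<close>; it is
  prime to \<open>p\<close>, and \<open>Q\<^sub>4 = 1\<close> would give the shorter period \<open>4\<close>.  So \<open>Q\<^sub>4 = 2\<close>
  (\<open>period_8_surd_den\<close>), which says that the convergent \<open>r / s = \<langle>n, a\<^sub>1, a\<^sub>2, a\<^sub>3\<rangle>\<close> satisfies
  \<open>r\<^sup>2 - p s\<^sup>2 = 2\<close>.

  Then \<open>(r + s \<surd>p)\<^sup>2 / 2 = (r\<^sup>2 - 1) + r s \<surd>p\<close> is a unit of norm \<open>1\<close>.  The fundamental unit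
  \<open>x + y \<surd>p\<close> has norm \<open>1\<close> too, because \<open>p \<equiv> 3 (mod 4)\<close>.  Every unit \<open>\<ge> 1\<close> of norm \<open>1\<close> is one of its
  powers, so \<open>y\<close> divides \<open>r s\<close> (\<open>minimal_pell_solution_dvd\<close>).  As \<open>p\<close> does not divide \<open>r\<close>, it remains
  to see that \<open>p\<close> does not divide \<open>s\<close>.

  Here \<open>s\<close> is the continuant \<open>K(a\<^sub>1, a\<^sub>2, a\<^sub>3)\<close> and \<open>r = n s + u\<close> with \<open>u = K(a\<^sub>2, a\<^sub>3)\<close>, so
  the norm equation forces \<open>u\<^sup>2 \<equiv> 2 (mod s)\<close>.  But \<open>v = K(a\<^sub>1, a\<^sub>2)\<close> is inverse to \<open>u\<close> modulo \<open>s\<close>, so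
  \<open>s\<close> divides \<open>2 v - u\<close>, where \<open>0 < u < s\<close> and \<open>0 < v < s\<close>.  This is so restrictive
  (\<open>continuant_square_cong_2_cases\<close>) that either \<open>s = 7\<close> or \<open>s\<close> is an explicit quadratic polynomial
  in \<open>a\<^sub>1\<close>; in the latter case the norm equation bounds \<open>a\<^sub>1\<close> and gives \<open>s < p\<close>
  (\<open>radicand_not_dvd_continuant\<close>).
\<close>

section \<open>A continued fraction determines its value\<close>

lemma complete_quotient_add:
  "complete_quotient x (m + k) = complete_quotient (complete_quotient x m) k"
  by (induction k) auto

lemma complete_quotient_irrational:
  assumes "x \<notin> \<rat>"
  shows "complete_quotient x k \<notin> \<rat>"
proof (induction k)
  case (Suc k)
  let ?z = "complete_quotient x k"
  show ?case
  proof
    assume "complete_quotient x (Suc k) \<in> \<rat>"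
    then have "1 / (1 / frac ?z) \<in> \<rat>"
      by (metis Rats_1 Rats_divide complete_quotient.simps(2))
    then have "frac ?z + of_int \<lfloor>?z\<rfloor> \<in> \<rat>" by (intro Rats_add) auto
    with Suc show False by (simp add: frac_def)
  qed
qed (use assms in simp)

lemma complete_quotient_step:
  assumes "x \<notin> \<rat>"
  shows "complete_quotient x k = partial_quotient x k + 1 / complete_quotient x (Suc k)"
    and "complete_quotient x (Suc k) > 1"
proof -
  let ?z = "complete_quotient x k"
  have "?z \<notin> \<int>"
    using complete_quotient_irrational[OF assms, of k] Ints_subset_Rats by blast
  then have "frac ?z > 0" by simp
  moreover have "frac ?z < 1" by (rule frac_lt_1)
  ultimately show "complete_quotient x (Suc k) > 1" by simp
  show "?z = partial_quotient x k + 1 / complete_quotient x (Suc k)"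
    by (simp add: partial_quotient_def frac_def)
qed

text \<open>
  The map \<open>z \<mapsto> 1 / frac z\<close> is expanding on a common branch: the difference of two numbers with
  the same integer part grows by the product of their images.
\<close>
lemma complete_quotient_diff:
  assumes x: "x \<notin> \<rat>" and y: "y \<notin> \<rat>" and pq: "partial_quotient x k = partial_quotient y k"
  shows "\<bar>complete_quotient x k - complete_quotient y k\<bar> *
           (complete_quotient x (Suc k) * complete_quotient y (Suc k)) =
         \<bar>complete_quotient x (Suc k) - complete_quotient y (Suc k)\<bar>"
proof -
  let ?X = "complete_quotient x (Suc k)" and ?Y = "complete_quotient y (Suc k)"
  have gt: "?X > 1" "?Y > 1" using complete_quotient_step(2) x y by blast+
  have "complete_quotient x k - complete_quotient y k = 1 / ?X - 1 / ?Y"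
    unfolding complete_quotient_step(1)[OF x, of k] complete_quotient_step(1)[OF y, of k] pq
    by simp
  then have "(complete_quotient x k - complete_quotient y k) * (?X * ?Y) = ?Y - ?X"
    using gt by (simp add: field_simps del: complete_quotient.simps)
  then have "\<bar>(complete_quotient x k - complete_quotient y k) * (?X * ?Y)\<bar> = \<bar>?X - ?Y\<bar>"
    by (simp add: abs_minus_commute del: complete_quotient.simps)
  then show ?thesis using gt by (simp only: abs_mult abs_of_pos)
qed

text \<open>
  A single complete quotient may be arbitrarily close to \<open>1\<close>, so one step need not expand by a
  fixed factor; two consecutive steps do.
\<close>
lemma complete_quotient_mult_gt_2:
  assumes "x \<notin> \<rat>"
  shows "complete_quotient x (Suc k) * complete_quotient x (Suc (Suc k)) > 2"
proof -
  let ?X = "complete_quotient x (Suc k)" and ?X' = "complete_quotient x (Suc (Suc k))"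
  have 1: "?X = partial_quotient x (Suc k) + 1 / ?X'" "?X > 1" "?X' > 1"
    using complete_quotient_step[OF assms] by blast+
  have "partial_quotient x (Suc k) \<ge> 1"
    using 1(2) unfolding partial_quotient_def by linarith
  then have "real_of_int (partial_quotient x (Suc k)) * ?X' \<ge> 1 * ?X'"
    using 1(3) by (intro mult_right_mono) auto
  moreover have "?X * ?X' = partial_quotient x (Suc k) * ?X' + 1"
    using 1(3) by (subst 1(1)) (simp add: field_simps del: complete_quotient.simps)
  ultimately show ?thesis using 1(3) by linarith
qed

text \<open>
  A continued fraction determines its value: the differences of corresponding complete quotients
  are always less than \<open>1\<close>, while every two steps at least double them, so all of them are \<open>0\<close>.
\<close>
lemma irrational_eqI_partial_quotient:
  assumes x: "x \<notin> \<rat>" and y: "y \<notin> \<rat>" and pq: "\<And>k. partial_quotient x k = partial_quotient y k"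
  shows "x = y"
proof -
  let ?d = "\<lambda>k. \<bar>complete_quotient x k - complete_quotient y k\<bar>"
  have bound: "?d k \<le> (1/2) ^ j" for j k
  proof (induction j arbitrary: k)
    case 0
    have "\<lfloor>complete_quotient x k\<rfloor> = \<lfloor>complete_quotient y k\<rfloor>"
      using pq[of k] by (simp add: partial_quotient_def)
    then show ?case by simp linarith
  next
    case (Suc j)
    let ?X = "complete_quotient x (Suc k)" and ?X' = "complete_quotient x (Suc (Suc k))"
    let ?Y = "complete_quotient y (Suc k)" and ?Y' = "complete_quotient y (Suc (Suc k))"
    have "?d (Suc (Suc k)) = ?d k * ((?X * ?X') * (?Y * ?Y'))"
      unfolding complete_quotient_diff[OF x y pq, symmetric] by (simp only: mult_ac)
    moreover have "(?X * ?X') * (?Y * ?Y') \<ge> 2 * 1"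
      using complete_quotient_mult_gt_2[OF x, of k] complete_quotient_mult_gt_2[OF y, of k]
      by (intro mult_mono) linarith+
    then have "?d k * ((?X * ?X') * (?Y * ?Y')) \<ge> ?d k * 2"
      by (intro mult_left_mono) auto
    ultimately show ?case using Suc[of "Suc (Suc k)"] by (simp del: complete_quotient.simps)
  qed
  have "?d 0 \<le> 0"
  proof (rule ccontr)
    assume "\<not> ?d 0 \<le> 0"
    then obtain j where "(1/2) ^ j < ?d 0"
      using real_arch_pow_inv[of "?d 0" "1/2"] by auto
    with bound[of 0 j] show False by linarith
  qed
  then show ?thesis by simp
qed

text \<open>
  Periods are defined by the partial quotients.  This lemma and the next one express them by a
  single recurrence of the complete quotients.
\<close>
lemma cf_periodI_complete_quotient:
  assumes "l > 0" and "complete_quotient x (Suc l) = complete_quotient x 1"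
  shows "cf_period x l"
  unfolding cf_period_def
proof (intro conjI allI impI)
  fix k :: nat assume "k \<ge> 1"
  then obtain j where k: "k = Suc j" by (cases k) auto
  have "complete_quotient x (Suc l + j) = complete_quotient x (1 + j)"
    unfolding complete_quotient_add assms(2) ..
  then show "partial_quotient x (k + l) = partial_quotient x k"
    by (simp add: partial_quotient_def k add.commute)
qed (use assms in simp)

lemma complete_quotient_cf_period:
  assumes "x \<notin> \<rat>" and "cf_period x l"
  shows "complete_quotient x (Suc l) = complete_quotient x 1"
proof (rule irrational_eqI_partial_quotient)
  fix k
  have "partial_quotient x (Suc k + l) = partial_quotient x (Suc k)"
    using assms(2) unfolding cf_period_def by (metis le_add1 plus_1_eq_Suc)
  then have "partial_quotient x (Suc l + k) = partial_quotient x (1 + k)"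
    by (simp add: add.commute)
  then show "partial_quotient (complete_quotient x (Suc l)) k =
      partial_quotient (complete_quotient x 1) k"
    unfolding partial_quotient_def complete_quotient_add .
qed (use complete_quotient_irrational[OF assms(1)] in blast)+

section \<open>Arithmetic of the integers of a real quadratic field\<close>

lemma sqrt_prime_irrational: "sqrt (real d) \<notin> \<rat>" if "prime d"
proof
  assume "sqrt (real d) \<in> \<rat>"
  moreover have "algebraic_int (sqrt (real d))" by (intro algebraic_int_sqrt int_imp_algebraic_int) auto
  ultimately have "sqrt (real d) \<in> \<int>" by (rule rational_algebraic_int_is_int[rotated])
  then obtain m where "sqrt (real d) = of_int m" by (auto elim: Ints_cases)
  then have "real d = (of_int m)\<^sup>2" by (metis of_nat_0_le_iff real_sqrt_pow2)
  then have m: "int d = m\<^sup>2" by (metis of_int_eq_iff of_int_of_nat_eq of_int_power)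
  have "prime (int d)" using that by simp
  then show False unfolding m by (simp add: prime_power_iff)
qed

lemma quadratic_integer_eq_iff:
  assumes irr: "sqrt (real d) \<notin> \<rat>"
  shows "of_int a + of_int b * sqrt (real d) = of_int a' + of_int b' * sqrt (real d) \<longleftrightarrow> a = a' \<and> b = b'"
proof
  assume eq: "of_int a + of_int b * sqrt (real d) = of_int a' + of_int b' * sqrt (real d)"
  have "b = b'"
  proof (rule ccontr)
    assume "b \<noteq> b'"
    then have "sqrt (real d) = of_int (a' - a) / of_int (b - b')"
      using eq by (simp add: field_simps)
    also have "\<dots> \<in> \<rat>" by (intro Rats_divide Rats_of_int)
    finally show False using irr by blast
  qed
  with eq show "a = a' \<and> b = b'" by simp
qed simp

text \<open>
  If the inverse \<open>v\<close> of \<open>e\<close> is integral, then \<open>v\<close> is a polynomial in \<open>e\<close> with integer coefficients: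
  multiply an integral equation of degree \<open>l + 1\<close> for \<open>v\<close> by \<open>e ^ l\<close>.
\<close>
lemma integral_inverse_mem:
  fixes e v :: real
  assumes int: "\<And>m. of_int m \<in> R" and add: "\<And>s t. s \<in> R \<Longrightarrow> t \<in> R \<Longrightarrow> s + t \<in> R"
    and mult: "\<And>s t. s \<in> R \<Longrightarrow> t \<in> R \<Longrightarrow> s * t \<in> R"
    and e: "e \<in> R" and ev: "e * v = 1" and v: "algebraic_int v"
  shows "v \<in> R"
proof -
  obtain q where q: "lead_coeff q = 1" "\<forall>i. coeff q i \<in> \<int>" "poly q v = 0"
    using v by (auto elim: algebraic_int.cases)
  define k where "k = degree q"
  have "k \<noteq> 0"
  proof
    assume "k = 0"
    then obtain c where "q = [:c:]" unfolding k_def by (rule degree_eq_zeroE)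
    with q show False by simp
  qed
  then obtain l where l: "k = Suc l" by (cases k) auto
  have cancel: "e ^ j * v ^ j = 1" for j
    by (metis ev power_mult_distrib power_one)
  have "0 = e ^ l * poly q v" using q by simp
  also have "\<dots> = (\<Sum>i\<le>k. coeff q i * (e ^ l * v ^ i))"
    by (simp add: poly_altdef k_def sum_distrib_left mult_ac)
  also have "\<dots> = (\<Sum>i\<le>l. coeff q i * (e ^ l * v ^ i)) + e ^ l * v ^ k"
    using q(1) unfolding l by (simp add: k_def[symmetric] l)
  also have "e ^ l * v ^ k = (e ^ l * v ^ l) * v" by (simp add: l)
  also have "\<dots> = v" unfolding cancel by simp
  also have "(\<Sum>i\<le>l. coeff q i * (e ^ l * v ^ i)) = (\<Sum>i\<le>l. coeff q i * e ^ (l - i))"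
  proof (rule sum.cong)
    fix i assume "i \<in> {..l}"
    then have "e ^ l * v ^ i = e ^ (l - i) * (e ^ i * v ^ i)"
      by (simp add: mult.assoc[symmetric] power_add[symmetric])
    then show "coeff q i * (e ^ l * v ^ i) = coeff q i * e ^ (l - i)" unfolding cancel by simp
  qed simp
  finally have "v = of_int (-1) * (\<Sum>i\<le>l. coeff q i * e ^ (l - i))" by simp
  moreover have pow: "e ^ j \<in> R" for j
  proof (induction j)
    case 0 show ?case using int[of 1] by simp
  qed (use mult e in simp)
  have "(\<Sum>i\<in>A. coeff q i * e ^ (l - i)) \<in> R" if "finite A" for A
    using that
  proof induction
    case empty show ?case using int[of 0] by simp
  next
    case (insert i A)
    obtain m where "coeff q i = of_int m" using q(2) by (meson Ints_cases)
    with insert int mult add pow show ?case by simp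
  qed
  ultimately show ?thesis using int mult by (metis finite_atMost)
qed

lemma quadratic_integer_mult:
  "(of_int a + of_int b * sqrt (real d)) * (of_int a' + of_int b' * sqrt (real d)) =
   of_int (a * a' + int d * b * b') + of_int (a * b' + b * a') * sqrt (real d)"
proof -
  have "sqrt (real d) * sqrt (real d) = real d" by simp
  then show ?thesis by (simp add: algebra_simps)
qed

text \<open>
  The ring of integers may be larger than \<open>\<int>[\<surd>d]\<close>, but the inverse of a unit that lies in \<open>\<int>[\<surd>d]\<close>
  lies there as well (\<open>integral_inverse_mem\<close>), and the norm is multiplicative.
\<close>
lemma unit_norm:
  assumes irr: "sqrt (real d) \<notin> \<rat>"
    and unit: "of_int x + of_int y * sqrt (real d) \<in> units_of_integers (real_quadratic_field d)"
  shows "\<bar>x\<^sup>2 - int d * y\<^sup>2\<bar> = 1"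
proof -
  define R where "R = {of_int a + of_int b * sqrt (real d) | a b. True}"
  obtain v where v: "algebraic_int v" "(of_int x + of_int y * sqrt (real d)) * v = 1"
    using unit unfolding units_of_integers_def ring_of_integers_def by blast
  have "v \<in> R"
  proof (rule integral_inverse_mem[OF _ _ _ _ v(2) v(1)])
    fix m show "of_int m \<in> R"
      unfolding R_def by (intro CollectI exI[of _ m] exI[of _ 0]) simp
  next
    fix s t assume "s \<in> R" "t \<in> R"
    then obtain a b a' b' where st: "s = of_int a + of_int b * sqrt (real d)"
      "t = of_int a' + of_int b' * sqrt (real d)" unfolding R_def by blast
    show "s + t \<in> R" unfolding R_def st
      by (intro CollectI exI[of _ "a + a'"] exI[of _ "b + b'"]) (simp add: algebra_simps)
    show "s * t \<in> R" unfolding R_def st quadratic_integer_mult by blast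
  qed (auto simp: R_def)
  then obtain a b where ab: "v = of_int a + of_int b * sqrt (real d)" by (auto simp: R_def)
  have "of_int (x * a + int d * y * b) + of_int (x * b + y * a) * sqrt (real d) =
      of_int 1 + of_int 0 * sqrt (real d)"
    using v(2) unfolding ab quadratic_integer_mult by simp
  then have one: "x * a + int d * y * b = 1" "x * b + y * a = 0"
    unfolding quadratic_integer_eq_iff[OF irr] by blast+
  have "(x\<^sup>2 - int d * y\<^sup>2) * (a\<^sup>2 - int d * b\<^sup>2) =
      (x * a + int d * y * b)\<^sup>2 - int d * (x * b + y * a)\<^sup>2"
    by (simp add: power2_eq_square algebra_simps)
  also have "\<dots> = 1" by (simp add: one)
  finally have "x\<^sup>2 - int d * y\<^sup>2 dvd 1" by (metis dvd_triv_left)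
  then show ?thesis by simp
qed

lemma pell_solution_unit:
  assumes "a\<^sup>2 - int d * b\<^sup>2 = 1"
  shows "of_int a + of_int b * sqrt (real d) \<in> units_of_integers (real_quadratic_field d)"
proof -
  have mem: "of_int a + of_int b * sqrt (real d) \<in> ring_of_integers (real_quadratic_field d)"
    if ab: "a\<^sup>2 - int d * b\<^sup>2 = 1" for a b
  proof -
    let ?z = "of_int a + of_int b * sqrt (real d)"
    have "of_int (a\<^sup>2 - int d * b\<^sup>2) = (1 :: real)" unfolding ab by simp
    then have "poly [:1, - 2 * of_int a, 1:] ?z = 0"
      by (simp add: power2_eq_square algebra_simps)
    moreover have "coeff [:1, - 2 * of_int a, 1 :: real:] i \<in> \<int>" for i
      by (auto simp: coeff_pCons split: nat.split)
    ultimately have "algebraic_int ?z" by (intro algebraic_int.intros[of "[:1, - 2 * of_int a, 1:]"]) auto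
    moreover have "?z \<in> real_quadratic_field d"
      unfolding real_quadratic_field_def using Rats_of_int by blast
    ultimately show ?thesis unfolding ring_of_integers_def by blast
  qed
  have "(of_int a + of_int b * sqrt (real d)) * (of_int a + of_int (- b) * sqrt (real d)) =
      of_int (a\<^sup>2 - int d * b\<^sup>2)"
    unfolding quadratic_integer_mult by (simp add: power2_eq_square)
  then show ?thesis
    unfolding units_of_integers_def using mem[OF assms] mem[of a "- b"] assms by auto
qed

text \<open>
  Descent: dividing a solution \<open>> 1\<close> by the minimal one \<open>e\<close> gives a solution \<open>\<ge> 1\<close> again, so all
  solutions are powers of \<open>e\<close>; and modulo \<open>y\<close>, where \<open>e\<close> is the integer \<open>x\<close>, all powers of \<open>e\<close> are
  integers.
\<close>
lemma minimal_pell_solution_dvd: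
  fixes x y :: int
  assumes norm: "x\<^sup>2 - int d * y\<^sup>2 = 1" and gt: "of_int x + of_int y * sqrt (real d) > 1"
    and min: "\<And>a b. a\<^sup>2 - int d * b\<^sup>2 = 1 \<Longrightarrow> of_int a + of_int b * sqrt (real d) > 1 \<Longrightarrow>
       of_int x + of_int y * sqrt (real d) \<le> of_int a + of_int b * sqrt (real d)"
    and ab: "a\<^sup>2 - int d * b\<^sup>2 = 1" "of_int a + of_int b * sqrt (real d) \<ge> 1"
  shows "y dvd b"
proof -
  define e where "e = of_int x + of_int y * sqrt (real d)"
  have step: "of_int a + of_int b * sqrt (real d) < e ^ k \<Longrightarrow> y dvd b" for k
    using ab
  proof (induction k arbitrary: a b)
    case 0 then show ?case by simp
  next
    case (Suc k)
    let ?h = "of_int a + of_int b * sqrt (real d)"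
    show ?case
    proof (cases "?h > 1")
      case True
      \<comment> \<open>The quotient \<open>(a + b \<surd>d) / (x + y \<surd>d)\<close>, by multiplication with the conjugate.\<close>
      define a' b' where "a' = a * x - int d * b * y" and "b' = b * x - a * y"
      let ?h' = "of_int a' + of_int b' * sqrt (real d)"
      have a: "a = a' * x + int d * b' * y" and b: "b = a' * y + b' * x"
      proof -
        have "a' * x + int d * b' * y = a * (x\<^sup>2 - int d * y\<^sup>2)"
          "a' * y + b' * x = b * (x\<^sup>2 - int d * y\<^sup>2)"
          by (simp_all add: a'_def b'_def power2_eq_square algebra_simps)
        then show "a = a' * x + int d * b' * y" "b = a' * y + b' * x" unfolding norm by simp_all
      qed
      have h: "?h = ?h' * e" unfolding e_def quadratic_integer_mult a b by simp
      have e1: "e > 1" using gt by (simp add: e_def)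
      have "e \<le> ?h" unfolding e_def by (rule min[OF Suc.prems(2) True])
      then have "1 \<le> ?h'" unfolding h using e1 by simp
      moreover have "?h' < e ^ k" using Suc.prems(1) e1 unfolding h by simp
      moreover have "a'\<^sup>2 - int d * b'\<^sup>2 = (a\<^sup>2 - int d * b\<^sup>2) * (x\<^sup>2 - int d * y\<^sup>2)"
        by (simp add: a'_def b'_def power2_eq_square algebra_simps)
      then have "a'\<^sup>2 - int d * b'\<^sup>2 = 1" using norm Suc.prems by simp
      ultimately have "y dvd b'" using Suc.IH by blast
      then show ?thesis unfolding b by simp
    next
      case False
      then have h: "?h = 1" using Suc.prems by simp
      have "?h * (of_int a + of_int (- b) * sqrt (real d)) = of_int (a\<^sup>2 - int d * b\<^sup>2)"
        unfolding quadratic_integer_mult by (simp add: power2_eq_square)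
      then have "of_int a + of_int (- b) * sqrt (real d) = 1" using h Suc.prems(2) by simp
      then have "of_int b * sqrt (real d) = 0" using h unfolding of_int_minus by linarith
      then have "b = 0 \<or> d = 0" by simp
      then show ?thesis
      proof
        assume "d = 0"
        then have "x\<^sup>2 = 1" "real_of_int x > 1" using norm gt by simp_all
        then show ?thesis by (auto simp: power2_eq_1_iff)
      qed simp
    qed
  qed
  obtain k where "of_int a + of_int b * sqrt (real d) < e ^ k"
    using real_arch_pow[of e] gt by (auto simp: e_def)
  then show ?thesis by (rule step)
qed

text \<open>
  Modulo \<open>4\<close> the norm is \<open>x\<^sup>2 + y\<^sup>2\<close>, and a sum of two squares is never congruent to \<open>3\<close>.
\<close>
lemma no_norm_minus_one:
  fixes x y :: int
  assumes "d mod 4 = (3 :: nat)"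
  shows "x\<^sup>2 - int d * y\<^sup>2 \<noteq> - 1"
proof
  assume eq: "x\<^sup>2 - int d * y\<^sup>2 = - 1"
  obtain k where d: "int d = 4 * k + 3"
    using assms by (metis div_mult_mod_eq mult.commute of_nat_add of_nat_mult of_nat_numeral)
  have sq: "\<exists>t. z\<^sup>2 = 4 * t \<or> z\<^sup>2 = 4 * t + 1" for z :: int
  proof (cases "even z")
    case True
    then obtain t where "z = 2 * t" by (rule evenE)
    then have "z\<^sup>2 = 4 * t\<^sup>2" by (simp add: power2_eq_square)
    then show ?thesis by blast
  next
    case False
    then obtain t where "z = 2 * t + 1" by (rule oddE)
    then have "z\<^sup>2 = 4 * (t\<^sup>2 + t) + 1" by (simp add: power2_eq_square algebra_simps)
    then show ?thesis by blast
  qed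
  obtain s where s: "x\<^sup>2 = 4 * s \<or> x\<^sup>2 = 4 * s + 1" using sq by blast
  obtain t where t: "y\<^sup>2 = 4 * t \<or> y\<^sup>2 = 4 * t + 1" using sq by blast
  define q where "q = (k + 1) * y\<^sup>2"
  have "x\<^sup>2 + y\<^sup>2 = 4 * q - 1" using eq unfolding d q_def by (simp add: algebra_simps)
  with s t show False by (elim disjE) (simp; presburger)+
qed

section \<open>Complete quotients of a square root and the palindromic period\<close>

text \<open>
  The integers with \<open>complete_quotient (sqrt d) k = (surd_num d k + sqrt d) / surd_den d k\<close>.  The
  division in the last equation is exact (\<open>surd_den_mult\<close>).
\<close>
fun surd_num :: "nat \<Rightarrow> nat \<Rightarrow> int" and surd_den :: "nat \<Rightarrow> nat \<Rightarrow> int" where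
  "surd_num d 0 = 0"
| "surd_num d (Suc k) = partial_quotient (sqrt (real d)) k * surd_den d k - surd_num d k"
| "surd_den d 0 = 1"
| "surd_den d (Suc k) =
     (int d - (partial_quotient (sqrt (real d)) k * surd_den d k - surd_num d k)\<^sup>2) div surd_den d k"

declare surd_num.simps(2) [simp del] surd_den.simps(2) [simp del] complete_quotient.simps(2) [simp del]

context
  fixes d :: nat
  assumes irr: "sqrt (real d) \<notin> \<rat>"
begin

private abbreviation (input) "a \<equiv> partial_quotient (sqrt (real d))"
private abbreviation (input) "P \<equiv> surd_num d"
private abbreviation (input) "Q \<equiv> surd_den d"

lemma sqrt_gt_1: "sqrt (real d) > 1"
proof -
  have "d \<noteq> 0" "d \<noteq> 1" using irr by (auto intro: ccontr)
  then show ?thesis by simp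
qed

text \<open>
  Rationalising \<open>1 / frac ((P + \<surd>d) / Q) = Q / (\<surd>d - P')\<close> gives \<open>(\<surd>d + P') / Q'\<close>.  The bounds
  on \<open>P'\<close> and \<open>Q'\<close> say that the new surd is reduced, i.e. that its conjugate lies in \<open>(-1, 0)\<close>;
  this holds after one step even if the old surd is not reduced, as is the case for \<open>\<surd>d\<close>
  itself.
\<close>
lemma surd_step:
  assumes Q: "Q k > 0" and P: "of_int (P k) < sqrt (real d)" and dvd: "Q k dvd int d - (P k)\<^sup>2"
    and cq: "complete_quotient (sqrt (real d)) k = (of_int (P k) + sqrt (real d)) / of_int (Q k)"
    and ge: "complete_quotient (sqrt (real d)) k > 1"
  shows "Q k * Q (Suc k) = int d - (P (Suc k))\<^sup>2"
    and "Q (Suc k) > 0" and "of_int (P (Suc k)) < sqrt (real d)"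
    and "sqrt (real d) - of_int (P (Suc k)) < of_int (Q (Suc k))"
    and "complete_quotient (sqrt (real d)) (Suc k) =
           (of_int (P (Suc k)) + sqrt (real d)) / of_int (Q (Suc k))"
proof -
  define r where "r = sqrt (real d)"
  have rr: "r * r = real d" by (simp add: r_def)
  let ?z = "complete_quotient (sqrt (real d)) k"
  have a1: "a k \<ge> 1" using ge by (simp add: partial_quotient_def)
  have P': "P (Suc k) = a k * Q k - P k" by (rule surd_num.simps)
  have "int d - (P (Suc k))\<^sup>2 = (int d - (P k)\<^sup>2) + Q k * (2 * a k * P k - a k * a k * Q k)"
    unfolding P' by (simp add: power2_eq_square algebra_simps)
  then have "Q k dvd int d - (P (Suc k))\<^sup>2" using dvd by (metis dvd_add dvd_triv_left)
  then show *: "Q k * Q (Suc k) = int d - (P (Suc k))\<^sup>2"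
    by (simp add: surd_num.simps(2) surd_den.simps(2))
  have "r - of_int (P (Suc k)) = of_int (Q k) * (?z - of_int (a k))"
    unfolding cq P' using Q by (simp add: r_def field_simps)
  then have fr: "r - of_int (P (Suc k)) = of_int (Q k) * frac ?z"
    by (simp add: frac_def partial_quotient_def)
  have "?z \<notin> \<int>" using complete_quotient_irrational[OF irr] Ints_subset_Rats by blast
  then have frp: "frac ?z > 0" by simp
  with fr Q have pos1: "r - of_int (P (Suc k)) > 0" by simp
  then show "of_int (P (Suc k)) < sqrt (real d)" by (simp add: r_def)
  have "of_int (a k) * real_of_int (Q k) \<ge> 1 * of_int (Q k)"
    using a1 Q by (intro mult_right_mono) auto
  \<comment> \<open>\<open>\<surd>d + P' = (\<surd>d - P) + a Q > Q\<close>, as the partial quotient \<open>a\<close> is at least \<open>1\<close>.\<close>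
  then have big: "r + of_int (P (Suc k)) > of_int (Q k)"
    using P unfolding P' r_def by simp
  have star: "of_int (Q k) * of_int (Q (Suc k)) = (r - of_int (P (Suc k))) * (r + of_int (P (Suc k)))"
    using arg_cong[OF *, of real_of_int] rr by (simp add: power2_eq_square algebra_simps)
  moreover have "(r - of_int (P (Suc k))) * (r + of_int (P (Suc k))) >
      (r - of_int (P (Suc k))) * of_int (Q k)"
    using pos1 big by (intro mult_strict_left_mono)
  ultimately have "of_int (Q k) * (r - of_int (P (Suc k))) < of_int (Q k) * real_of_int (Q (Suc k))"
    by (simp add: mult.commute)
  then show less: "sqrt (real d) - of_int (P (Suc k)) < of_int (Q (Suc k))"
    using Q by (simp add: r_def)
  with pos1 have Q'r: "real_of_int (Q (Suc k)) > 0" unfolding r_def by linarith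
  then show "Q (Suc k) > 0" by simp
  have "complete_quotient (sqrt (real d)) (Suc k) = of_int (Q k) / (r - of_int (P (Suc k)))"
    unfolding fr using Q by (simp add: complete_quotient.simps)
  also have "\<dots> = (of_int (P (Suc k)) + r) / of_int (Q (Suc k))"
    using star pos1 Q'r by (simp add: field_simps)
  finally show "complete_quotient (sqrt (real d)) (Suc k) =
           (of_int (P (Suc k)) + sqrt (real d)) / of_int (Q (Suc k))" by (simp add: r_def)
qed

lemma complete_quotient_sqrt_gt_1: "complete_quotient (sqrt (real d)) k > 1"
  using sqrt_gt_1 complete_quotient_step(2)[OF irr] by (cases k) auto

lemma surd_invariant:
  "Q k > 0 \<and> of_int (P k) < sqrt (real d) \<and> Q k dvd int d - (P k)\<^sup>2 \<and>
   complete_quotient (sqrt (real d)) k = (of_int (P k) + sqrt (real d)) / of_int (Q k)"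
proof (induction k)
  case 0
  then show ?case using sqrt_gt_1 by simp
next
  case (Suc k)
  then have IH: "Q k > 0" "of_int (P k) < sqrt (real d)" "Q k dvd int d - (P k)\<^sup>2"
    "complete_quotient (sqrt (real d)) k = (of_int (P k) + sqrt (real d)) / of_int (Q k)"
    by blast+
  note st = surd_step[OF IH complete_quotient_sqrt_gt_1]
  have "Q (Suc k) dvd int d - (P (Suc k))\<^sup>2"
    unfolding st(1)[symmetric] by simp
  with st show ?case by blast
qed

lemma
  shows surd_den_pos: "Q k > 0"
    and surd_num_less: "of_int (P k) < sqrt (real d)"
    and complete_quotient_sqrt:
      "complete_quotient (sqrt (real d)) k = (of_int (P k) + sqrt (real d)) / of_int (Q k)"
    and surd_den_mult: "Q k * Q (Suc k) = int d - (P (Suc k))\<^sup>2"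
    and surd_reduced: "sqrt (real d) - of_int (P (Suc k)) < of_int (Q (Suc k))"
  using surd_invariant[of k] surd_step(1,4)[of k] complete_quotient_sqrt_gt_1[of k] by blast+

lemma surd_num_Suc: "P (Suc k) = a k * Q k - P k" by (simp add: surd_num.simps(2))

lemma surd_num_1: "P 1 = \<lfloor>sqrt (real d)\<rfloor>"
  by (simp add: surd_num_Suc partial_quotient_def)

text \<open>
  A reduced surd with denominator \<open>1\<close> has \<open>\<surd>d - 1 < P < \<surd>d\<close>.
\<close>
lemma surd_den_eq_1:
  assumes "Q (Suc k) = 1"
  shows "P (Suc k) = \<lfloor>sqrt (real d)\<rfloor>"
  using surd_num_less[of "Suc k"] surd_reduced[of k] assms by linarith

lemma surd_eqD:
  assumes "(of_int A + sqrt (real d)) / of_int B = (of_int A' + sqrt (real d)) / of_int B'"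
    and "B > 0" "B' > 0"
  shows "A = A' \<and> B = B'"
proof -
  have "of_int (A * B') + of_int B' * sqrt (real d) = of_int (A' * B) + of_int B * sqrt (real d)"
    using assms by (simp add: field_simps)
  then have "A * B' = A' * B \<and> B' = B" unfolding quadratic_integer_eq_iff[OF irr] .
  with assms(2,3) show ?thesis by auto
qed

text \<open>
  Since the period starts at index \<open>1\<close>, the recurrence only gives \<open>Q\<^sub>l\<^sub>+\<^sub>1 = Q\<^sub>1\<close> and
  \<open>P\<^sub>l\<^sub>+\<^sub>1 = P\<^sub>1\<close>; the symmetric relation \<open>surd_den_mult\<close> carries the equality of denominators
  one step back to \<open>Q\<^sub>l = Q\<^sub>0\<close>.
\<close>
lemma surd_den_period:
  assumes "cf_period (sqrt (real d)) l"
  shows "Q l = 1"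
proof -
  have "complete_quotient (sqrt (real d)) (Suc l) = complete_quotient (sqrt (real d)) 1"
    by (rule complete_quotient_cf_period[OF irr assms])
  then have eq: "P (Suc l) = P 1" "Q (Suc l) = Q 1"
    unfolding complete_quotient_sqrt using surd_eqD surd_den_pos by blast+
  have "Q l * Q 1 = Q 0 * Q 1"
    using surd_den_mult[of l] surd_den_mult[of 0] unfolding eq by simp
  then show ?thesis using surd_den_pos[of 1] by simp
qed

text \<open>
  Denominator \<open>1\<close> means that the complete quotient is \<open>n + \<surd>d\<close> with \<open>n = \<lfloor>\<surd>d\<rfloor>\<close>, which has the
  same fractional part as \<open>\<surd>d\<close>.
\<close>
lemma cf_periodI_surd_den:
  assumes "k > 0" "Q k = 1"
  shows "cf_period (sqrt (real d)) k"
proof (rule cf_periodI_complete_quotient[OF assms(1)])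
  have Pk: "P k = \<lfloor>sqrt (real d)\<rfloor>" using surd_den_eq_1[of "k - 1"] assms by simp
  have "a k = 2 * \<lfloor>sqrt (real d)\<rfloor>"
    unfolding partial_quotient_def complete_quotient_sqrt Pk assms(2) by simp
  then have "P (Suc k) = P 1"
    unfolding surd_num_1 surd_num_Suc[of k] using Pk assms(2) by simp
  moreover from this have "Q (Suc k) = Q 1"
    using surd_den_mult[of k] surd_den_mult[of 0] assms(2) by simp
  ultimately show "complete_quotient (sqrt (real d)) (Suc k) = complete_quotient (sqrt (real d)) 1"
    by (simp add: complete_quotient_sqrt)
qed

text \<open>
  The expansion can be run backwards: the conjugate of a reduced surd lies in \<open>(-1, 0)\<close>, so a
  partial quotient can be read off from the numerator of the following complete quotient by the
  same formula as from its own.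
\<close>
lemma partial_quotient_reverse:
  "a (Suc i) = \<lfloor>(of_int (P (Suc (Suc i))) + sqrt (real d)) / of_int (Q (Suc i))\<rfloor>"
proof -
  have q: "real_of_int (Q (Suc i)) > 0" using surd_den_pos by simp
  have "(of_int (P (Suc (Suc i))) + sqrt (real d)) / of_int (Q (Suc i)) =
      of_int (a (Suc i)) + (sqrt (real d) - of_int (P (Suc i))) / of_int (Q (Suc i))"
    unfolding surd_num_Suc[of "Suc i"] using q by (simp add: field_simps)
  moreover have "0 < (sqrt (real d) - of_int (P (Suc i))) / of_int (Q (Suc i))"
    using surd_num_less[of "Suc i"] q by simp
  moreover have "(sqrt (real d) - of_int (P (Suc i))) / of_int (Q (Suc i)) < 1"
    using surd_reduced[of i] q by simp
  ultimately show ?thesis by linarith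
qed

lemma surd_reflect_step:
  assumes "P (Suc (Suc i)) = P j" and "Q (Suc i) = Q j"
  shows "P (Suc i) = P (Suc j) \<and> Q i = Q (Suc j)"
proof -
  have "a (Suc i) = a j"
    unfolding partial_quotient_reverse assms by (simp add: partial_quotient_def complete_quotient_sqrt)
  then have P: "P (Suc i) = P (Suc j)"
    using surd_num_Suc[of "Suc i"] surd_num_Suc[of j] assms by simp
  have "Q i * Q (Suc i) = Q j * Q (Suc j)"
    unfolding surd_den_mult P ..
  with P show ?thesis using assms(2) surd_den_pos[of j] by (simp add: mult.commute)
qed

text \<open>
  Reading a period backwards from its last index gives the same recursion with the same start, so
  the period is a palindrome.
\<close>
lemma surd_palindrome:
  assumes "Q (Suc l) = 1" and "j \<le> l"
  shows "P (Suc l - j) = P (Suc j) \<and> Q (l - j) = Q (Suc j)"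
  using assms(2)
proof (induction j)
  case 0
  have P: "P (Suc l) = P (Suc 0)"
    using surd_den_eq_1[OF assms(1)] surd_num_1 by simp
  have "Q l * Q (Suc l) = Q 0 * Q (Suc 0)" unfolding surd_den_mult P ..
  with P assms(1) show ?case by simp
next
  case (Suc j)
  then obtain i where i: "l - j = Suc i" by (cases "l - j") auto
  then have "Suc l - j = Suc (Suc i)" "Suc l - Suc j = Suc i" "l - Suc j = i" by auto
  with Suc i surd_reflect_step[of i "Suc j"] show ?case by simp
qed

end

section \<open>Norms of the convergents\<close>

text \<open>
  Numerators and denominators of the convergents, shifted by one: index \<open>k + 1\<close> belongs to the
  convergent that ends with the partial quotient \<open>k\<close>, and index \<open>0\<close> to the formal convergent
  \<open>1 / 0\<close>.
\<close>
fun conv_num :: "nat \<Rightarrow> nat \<Rightarrow> int" where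
  "conv_num d 0 = 1"
| "conv_num d (Suc 0) = partial_quotient (sqrt (real d)) 0"
| "conv_num d (Suc (Suc k)) =
     partial_quotient (sqrt (real d)) (Suc k) * conv_num d (Suc k) + conv_num d k"

fun conv_den :: "nat \<Rightarrow> nat \<Rightarrow> int" where
  "conv_den d 0 = 0"
| "conv_den d (Suc 0) = 1"
| "conv_den d (Suc (Suc k)) =
     partial_quotient (sqrt (real d)) (Suc k) * conv_den d (Suc k) + conv_den d k"

text \<open>
  The denominators of the complete quotients are, up to sign, the norms of the convergents.  The
  induction also needs the previous norm and the mixed product of two consecutive convergents,
  since the norm is a quadratic form and convergents obey a recursion of order two.
\<close>
lemma convergent_norm:
  assumes irr: "sqrt (real d) \<notin> \<rat>"
  shows "(conv_num d k)\<^sup>2 - int d * (conv_den d k)\<^sup>2 = (-1) ^ k * surd_den d k \<and>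
    (conv_num d (Suc k))\<^sup>2 - int d * (conv_den d (Suc k))\<^sup>2 = (-1) ^ Suc k * surd_den d (Suc k) \<and>
    conv_num d (Suc k) * conv_num d k - int d * conv_den d (Suc k) * conv_den d k =
      (-1) ^ k * surd_num d (Suc k)"
proof (induction k)
  case 0
  show ?case using surd_den_mult[OF irr, of 0] surd_num_Suc[OF irr, of 0]
    by (simp add: algebra_simps)
next
  case (Suc k)
  define e :: int where "e = (-1) ^ k"
  define b where "b = partial_quotient (sqrt (real d)) (Suc k)"
  define A A' B B' where "A = conv_num d (Suc k)" "A' = conv_num d k"
    "B = conv_den d (Suc k)" "B' = conv_den d k"
  define p p' q q' q'' where "p = surd_num d (Suc k)" "p' = surd_num d (Suc (Suc k))"
    "q = surd_den d (Suc k)" "q' = surd_den d k" "q'' = surd_den d (Suc (Suc k))"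
  note defs = e_def b_def A_A'_B_B'_def p_p'_q_q'_q''_def
  have 1: "A'\<^sup>2 - int d * B'\<^sup>2 = e * q'" "A\<^sup>2 - int d * B\<^sup>2 = - e * q"
    "A * A' - int d * B * B' = e * p"
    using Suc by (simp_all add: defs)
  have 2: "p' = b * q - p" using surd_num_Suc[OF irr, of "Suc k"] by (simp add: defs)
  have 3: "q' * q = int d - p\<^sup>2" "q * q'' = int d - p'\<^sup>2"
    using surd_den_mult[OF irr] by (simp_all add: defs)
  have "q * q'' = q * (q' + b * (p - p'))"
    unfolding 3(2) 2 using 3(1) by (simp add: algebra_simps power2_eq_square)
  then have 4: "q'' = q' + b * (p - p')"
    using surd_den_pos[OF irr, of "Suc k"] by (simp add: defs)
  have "(b * A + A')\<^sup>2 - int d * (b * B + B')\<^sup>2 =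
    b * b * (A\<^sup>2 - int d * B\<^sup>2) + 2 * b * (A * A' - int d * B * B') + (A'\<^sup>2 - int d * B'\<^sup>2)"
    by (simp add: algebra_simps power2_eq_square)
  also have "\<dots> = e * q''" unfolding 1 4 2 by (simp add: algebra_simps)
  finally have X: "(b * A + A')\<^sup>2 - int d * (b * B + B')\<^sup>2 = e * q''" .
  have "(b * A + A') * A - int d * (b * B + B') * B =
    b * (A\<^sup>2 - int d * B\<^sup>2) + (A * A' - int d * B * B')"
    by (simp add: algebra_simps power2_eq_square)
  also have "\<dots> = - e * p'" unfolding 1 2 by (simp add: algebra_simps)
  finally have Y: "(b * A + A') * A - int d * (b * B + B') * B = - e * p'" .
  show ?case using 1(2) X Y by (simp add: defs)
qed

section \<open>A congruence between continuants\<close>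

text \<open>
  With the continuants \<open>u = K(b, c)\<close> and \<open>v = K(a, b)\<close> one has \<open>u v = s b + 1\<close>.  Multiplying
  \<open>u\<^sup>2 \<equiv> 2 (mod s)\<close> by \<open>v\<close> gives \<open>u \<equiv> 2 v (mod s)\<close>; since \<open>u\<close> and \<open>v\<close> lie strictly between \<open>0\<close>
  and \<open>s\<close>, only \<open>u = 2 v\<close> and \<open>u = 2 v - s\<close> remain, and each of them is solved directly.
\<close>
lemma continuant_square_cong_2_cases:
  fixes a b c :: int
  assumes "a \<ge> 1" "b \<ge> 1" "c \<ge> 1"
    and s: "s = a * b * c + a + c" and u: "u = b * c + 1"
    and dvd: "s dvd u\<^sup>2 - 2"
  shows "b = 1 \<and> c = 2 * a + 1 \<or> a = 2 \<and> b = 2 \<and> c = 1"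
proof -
  define v where "v = a * b + 1"
  have uv: "u * v = s * b + 1" by (simp add: s u v_def algebra_simps)
  have "u + s * (u * b) = u * (u * v)" by (simp add: uv algebra_simps)
  also have "\<dots> = (u\<^sup>2 - 2) * v + 2 * v" by (simp add: power2_eq_square algebra_simps)
  finally have "2 * v - u = s * (u * b) - (u\<^sup>2 - 2) * v" by simp
  then have "s dvd 2 * v - u" using dvd by simp
  then obtain j where j: "2 * v - u = s * j" by blast
  have pos: "a * b \<ge> 1" "b * c \<ge> 1" "u \<ge> 1" "v \<ge> 1" using assms(1-3) unfolding u v_def
    by (auto simp: int_one_le_iff_zero_less)
  have "s = a * u + c" "s = c * v + a" by (auto simp: s u v_def algebra_simps)
  moreover have "1 * u \<le> a * u" "1 * v \<le> c * v" using assms pos by (auto intro!: mult_right_mono)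
  ultimately have less: "u < s" "v < s" using assms(1-3) by linarith+
  have "s * j < s * 2" "s * (-1) < s * j" unfolding j[symmetric] using less pos by linarith+
  then have "j < 2" "- 1 < j" using less pos by (simp_all only: mult_less_cancel_left_pos)
  then have "j = 0 \<or> j = 1" by linarith
  then show ?thesis
  proof
    assume "j = 0"
    then have "b * (c - 2 * a) = 1" using j by (simp add: u v_def algebra_simps)
    then show ?thesis using assms(2) by (auto simp: zmult_eq_1_iff)
  next
    assume "j = 1"
    then have eq: "b * (a * c + c - 2 * a) + a + c = 1" using j by (simp add: s u v_def algebra_simps)
    have "c = 1"
    proof (rule ccontr)
      assume "c \<noteq> 1"
      then have "a * 2 \<le> a * c" using assms by (intro mult_left_mono) auto
      then have "0 \<le> a * c + c - 2 * a" using assms(3) by linarith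
      then have "0 \<le> b * (a * c + c - 2 * a)" using assms(2) by simp
      with eq assms show False by linarith
    qed
    with eq have eq': "b * (a - 1) = a" by (simp add: algebra_simps)
    then have "(b - 1) * (a - 1) = 1" by (simp add: algebra_simps)
    then have "a = 2" using assms(1) by (auto simp: zmult_eq_1_iff)
    with eq' \<open>c = 1\<close> show ?thesis by simp
  qed
qed

text \<open>
  The norm equation gives \<open>u\<^sup>2 \<equiv> 2 (mod s)\<close>, so \<open>continuant_square_cong_2_cases\<close> applies.  In the family
  \<open>(a, 1, 2 a + 1)\<close>, with \<open>B = a + 1\<close> and \<open>m = d - n\<^sup>2\<close>, one gets \<open>s = 2 B\<^sup>2 - 1\<close> and
  \<open>m s = 4 n B + 2\<close>.  This has no solution for \<open>m \<le> 2\<close>; for \<open>m \<ge> 3\<close> it bounds \<open>B\<close> by about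
  \<open>2 n / 3\<close> and hence \<open>s\<close> by about \<open>8 n\<^sup>2 / 9\<close>, which is less than \<open>d\<close>.
\<close>
lemma radicand_not_dvd_continuant:
  fixes a b c n d :: int
  assumes "a \<ge> 1" "b \<ge> 1" "c \<ge> 1" "n \<ge> 1" and n: "n\<^sup>2 < d"
    and s: "s = a * b * c + a + c" and u: "u = b * c + 1"
    and norm: "(n * s + u)\<^sup>2 - d * s\<^sup>2 = 2"
  shows "\<not> d dvd s"
proof
  assume dvd: "d dvd s"
  have abc: "a * b \<ge> 1" "a * b * c \<ge> 1" using assms(1-3) by (auto simp: int_one_le_iff_zero_less)
  then have "s > 0" using assms(1-3) s by linarith
  with dvd have ds: "d \<le> s" by (simp add: zdvd_imp_le)
  have eq: "u\<^sup>2 - 2 = s * (d * s - n\<^sup>2 * s - 2 * n * u)"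
    using norm by (simp add: power2_eq_square algebra_simps)
  then have "s dvd u\<^sup>2 - 2" by simp
  from continuant_square_cong_2_cases[OF assms(1-3) s u this] show False
  proof (elim disjE conjE)
    assume abc: "a = 2" "b = 2" "c = 1"
    then have su: "s = 7" "u = 3" by (simp_all add: s u)
    then have "(7 * n + 3)\<^sup>2 - d * 49 = 2" using norm by (simp add: mult.commute)
    then have eq7: "49 * (d - n * n) = 42 * n + 7" by (simp add: power2_eq_square algebra_simps)
    have "n\<^sup>2 < 7" using n ds su by simp
    then have "n < 3" using power_mono[of 3 n 2] by force
    then have "n = 1 \<or> n = 2" using assms(4) by linarith
    then have "d = 2"
    proof
      assume "n = 2"
      with eq7 have "49 * (d - 4) = 91" by simp
      then show ?thesis by presburger
    qed (use eq7 in simp)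
    with dvd su show False by simp
  next
    assume bc: "b = 1" "c = 2 * a + 1"
    define B m where "B = a + 1" and "m = d - n\<^sup>2"
    have B: "B \<ge> 2" and m: "m \<ge> 1" using assms(1) n by (auto simp: B_def m_def)
    have sB: "s = 2 * B\<^sup>2 - 1" and uB: "u = 2 * B"
      by (simp_all add: s u bc B_def power2_eq_square algebra_simps)
    have "s * 2 = s * (d * s - n\<^sup>2 * s - 2 * n * u)"
      unfolding eq[symmetric] by (simp add: sB uB power2_eq_square)
    then have "d * s - n\<^sup>2 * s - 2 * n * u = 2" using \<open>s > 0\<close> by simp
    then have ms: "m * (2 * B\<^sup>2 - 1) = 4 * n * B + 2"
      by (simp add: m_def sB uB algebra_simps)
    consider "m = 1" | "m = 2" | "m \<ge> 3" using m by linarith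
    then show False
    proof cases
      case 1
      then have "2 * (B\<^sup>2 - 2 * (n * B)) = 3" using ms by (simp add: algebra_simps)
      then show False by presburger
    next
      case 2
      with ms have "B * (B - n) = 1" by (simp add: power2_eq_square algebra_simps)
      then show False using B by (auto simp: zmult_eq_1_iff)
    next
      case 3
      have "B\<^sup>2 \<ge> 1" using B by (simp add: int_one_le_iff_zero_less)
      then have "3 * (2 * B\<^sup>2 - 1) \<le> m * (2 * B\<^sup>2 - 1)" using 3 by (intro mult_right_mono) auto
      then have le: "B * (6 * B - 4 * n) \<le> 5" unfolding ms by (simp add: power2_eq_square algebra_simps)
      have B3: "3 * B \<le> 2 * n + 1"
      proof (rule ccontr)
        assume "\<not> 3 * B \<le> 2 * n + 1"
        then have "2 * 4 \<le> B * (6 * B - 4 * n)" using B by (intro mult_mono) auto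
        with le show False by simp
      qed
      then have "(3 * B)\<^sup>2 \<le> (2 * n + 1)\<^sup>2" using B by (intro power_mono) auto
      moreover have "(n - 4)\<^sup>2 \<ge> 0" by simp
      moreover have "n\<^sup>2 + 3 \<le> 2 * B\<^sup>2 - 1" using ds 3 sB by (simp add: m_def)
      \<comment> \<open>The three facts together amount to \<open>(n - 4)\<^sup>2 + 18 \<le> 0\<close>.\<close>
      ultimately show False by (simp add: power2_eq_square algebra_simps)
    qed
  qed
qed

section \<open>Period length 8\<close>

text \<open>
  At the centre of the palindrome \<open>2 P\<^sub>4 = P\<^sub>4 + P\<^sub>5\<close> is a multiple of \<open>Q\<^sub>4\<close>, so \<open>Q\<^sub>4\<close> divides
  \<open>2 p = 2 Q\<^sub>3 Q\<^sub>4 + 2 P\<^sub>4\<^sup>2\<close>.  The prime \<open>p\<close> cannot contribute, since \<open>0 < P\<^sub>4 < \<surd>p\<close>, and \<open>Q\<^sub>4 \<noteq> 1\<close> is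
  the minimality of the period.
\<close>
lemma period_8_surd_den:
  assumes p: "prime p" and per: "has_cf_period_length (sqrt (real p)) 8"
  shows "surd_den p 4 = 2"
proof -
  have irr: "sqrt (real p) \<notin> \<rat>" by (rule sqrt_prime_irrational[OF p])
  let ?P = "surd_num p 4" and ?Q = "surd_den p 4"
  have "surd_den p (Suc 7) = 1" using surd_den_period[OF irr] per
    by (simp add: has_cf_period_length_def)
  from surd_palindrome[OF irr this, of 3] have "surd_num p (Suc 4) = ?P" by simp
  then have central: "2 * ?P = partial_quotient (sqrt (real p)) 4 * ?Q"
    using surd_num_Suc[OF irr, of 4] by simp
  have den: "surd_den p 3 * ?Q = int p - ?P\<^sup>2"
    using surd_den_mult[OF irr, of 3] by simp
  have pos: "?Q > 0" "?P > 0"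
  proof -
    show "?Q > 0" by (rule surd_den_pos[OF irr])
    have "partial_quotient (sqrt (real p)) 4 \<ge> 1"
      using complete_quotient_sqrt_gt_1[OF irr, of 4] unfolding partial_quotient_def by linarith
    with \<open>?Q > 0\<close> have "0 < partial_quotient (sqrt (real p)) 4 * ?Q" by simp
    then show "?P > 0" using central by linarith
  qed
  have not_dvd: "\<not> int p dvd ?Q"
  proof
    assume "int p dvd ?Q"
    then have "int p dvd int p - surd_den p 3 * ?Q" by simp
    then have "int p dvd ?P\<^sup>2" using den by simp
    then have "int p dvd ?P" using p by (simp add: prime_dvd_power_iff)
    then have "int p \<le> ?P" using pos by (simp add: zdvd_imp_le)
    then have "real p < sqrt (real p)" using surd_num_less[OF irr, of 4] by linarith
    moreover have "sqrt (real p) * 1 \<le> sqrt (real p) * sqrt (real p)"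
      using sqrt_gt_1[OF irr] by (intro mult_left_mono) auto
    ultimately show False by simp
  qed
  have "2 * int p = ?Q * (2 * surd_den p 3) + (2 * ?P) * ?P"
    using den by (simp add: power2_eq_square algebra_simps)
  then have "?Q dvd 2 * int p" unfolding central by simp
  moreover have "coprime ?Q (int p)"
    using not_dvd p by (metis coprime_commute prime_imp_coprime prime_nat_int_transfer)
  ultimately have "?Q dvd 2" by (simp add: coprime_dvd_mult_left_iff)
  then have "?Q \<le> 2" by (simp add: zdvd_imp_le)
  moreover have "?Q \<noteq> 1"
  proof
    assume "?Q = 1"
    then have "cf_period (sqrt (real p)) 4" by (intro cf_periodI_surd_den[OF irr]) auto
    then show False using per by (auto simp: has_cf_period_length_def)
  qed
  ultimately show ?thesis using pos by linarith
qed

theorem corollary4p4: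
  fixes p :: nat and x y :: int
  assumes "prime p"
    and "p mod 4 = 3"
    and "has_cf_period_length (sqrt (real p)) 8"
    and "is_fundamental_unit p (of_int x + of_int y * sqrt (real p))"
  shows "\<not> int p dvd y"
proof
  assume dvd_y: "int p dvd y"
  have irr: "sqrt (real p) \<notin> \<rat>" by (rule sqrt_prime_irrational[OF assms(1)])
  define a where "a = partial_quotient (sqrt (real p))"
  define r s u where "r = conv_num p 4" and "s = conv_den p 4" and "u = a 2 * a 3 + 1"
  have norm: "r\<^sup>2 - int p * s\<^sup>2 = 2"
    using convergent_norm[OF irr, of 4] period_8_surd_den[OF assms(1,3)] by (simp add: r_def s_def)
  have s: "s = a 1 * a 2 * a 3 + a 1 + a 3" and r: "r = a 0 * s + u"
    by (simp_all add: r_def s_def u_def a_def eval_nat_numeral algebra_simps)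
  have a: "a k \<ge> 1" for k
    using complete_quotient_sqrt_gt_1[OF irr, of k] unfolding a_def partial_quotient_def by linarith
  have "real_of_int (a 0) < sqrt (real p)"
    using surd_num_less[OF irr, of 1] surd_num_1[OF irr] by (simp add: a_def partial_quotient_def)
  then have "(real_of_int (a 0))\<^sup>2 < (sqrt (real p))\<^sup>2" using a[of 0] by (intro power_strict_mono) auto
  then have "real_of_int ((a 0)\<^sup>2) < real_of_int (int p)" by simp
  then have a0: "(a 0)\<^sup>2 < int p" by linarith
  have ndvd_s: "\<not> int p dvd s"
    using norm unfolding r
    by (intro radicand_not_dvd_continuant[OF a a a a a0 s u_def])
  have ndvd_r: "\<not> int p dvd r"
  proof
    assume "int p dvd r"
    then have "int p dvd r\<^sup>2 - int p * s\<^sup>2" by (simp add: power2_eq_square)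
    then have "int p dvd 2" unfolding norm .
    then have "int p \<le> 2" by (rule zdvd_imp_le) simp
    with assms(2) show False by auto
  qed
  \<comment> \<open>\<open>(r + s \<surd>p)\<^sup>2 / 2 = (r\<^sup>2 - 1) + r s \<surd>p\<close>, because \<open>r\<^sup>2 + p s\<^sup>2 = 2 r\<^sup>2 - 2\<close>.\<close>
  have eta: "(r\<^sup>2 - 1)\<^sup>2 - int p * (r * s)\<^sup>2 = 1"
  proof -
    have "(r\<^sup>2 - 1)\<^sup>2 - int p * (r * s)\<^sup>2 = r\<^sup>2 * (r\<^sup>2 - int p * s\<^sup>2) - 2 * r\<^sup>2 + 1"
      by (simp add: power2_eq_square algebra_simps)
    then show ?thesis unfolding norm by simp
  qed
  have pos: "s \<ge> 1" "r \<ge> 2"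
  proof -
    have "a 1 * a 2 * a 3 \<ge> 1" using a by (simp add: int_one_le_iff_zero_less less_le_trans[OF zero_less_one])
    then show "s \<ge> 1" using a[of 1] a[of 3] unfolding s by linarith
    then have "a 0 * s \<ge> 1" "a 2 * a 3 \<ge> 1"
      using a[of 0] a[of 2] a[of 3] by (simp_all add: int_one_le_iff_zero_less)
    then show "r \<ge> 2" unfolding r u_def by linarith
  qed
  have eta_ge: "of_int (r\<^sup>2 - 1) + of_int (r * s) * sqrt (real p) \<ge> 1"
  proof -
    have "r\<^sup>2 \<ge> 2\<^sup>2" using pos by (intro power_mono) auto
    then have "r\<^sup>2 - 1 \<ge> 1" by simp
    then have "real_of_int (r\<^sup>2 - 1) \<ge> 1" by (simp only: of_int_1_le_iff)
    moreover have "of_int (r * s) * sqrt (real p) \<ge> 0" using pos by simp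
    ultimately show ?thesis by linarith
  qed
  have unit: "of_int x + of_int y * sqrt (real p) \<in> units_of_integers (real_quadratic_field p)"
    and gt: "of_int x + of_int y * sqrt (real p) > 1"
    and min: "\<And>u. u \<in> units_of_integers (real_quadratic_field p) \<Longrightarrow> u > 1 \<Longrightarrow>
      of_int x + of_int y * sqrt (real p) \<le> u"
    using assms(4) unfolding is_fundamental_unit_def by blast+
  have "x\<^sup>2 - int p * y\<^sup>2 = 1"
    using unit_norm[OF irr unit] no_norm_minus_one[OF assms(2), of x y] by linarith
  then have "y dvd r * s"
    using minimal_pell_solution_dvd[OF _ gt min[OF pell_solution_unit] eta eta_ge] by blast
  with dvd_y have "int p dvd r * s" by (rule dvd_trans)
  then show False
    using ndvd_r ndvd_s assms(1) by (simp add: prime_dvd_mult_iff)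
qed

end
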